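(* Let $p$ be an Ising model on vertex set $V$, $|V|=n$, in the high-temperature regime with arbitrary external field, and let $X^{(1)},X^{(2)}$ be two independent samples from $p$ (equivalently, a sample from $p^{\otimes 2}$). Let $c\in[-1,1]^{\binom V2}$ and define $g_c(X)=\sum_{\{u,v\}\in\binom V2}c_{uv}\big(X^{(1)}_u-X^{(2)}_u\big)\big(X^{(1)}_v-X^{(2)}_v\big)$. Then $\mathbf{Var}(g_c(X))=\tilde O(n^2)$.
   Context: An Ising model on vertex set $V$ is the distribution on $\{-1,1\}^V$ with $p(x)\propto\exp\big(\sum_{v}\theta_v x_v+\sum_{u\ne v}\theta_{uv}x_ux_v\big)$. High-temperature regime (Dobrushin's condition): $\max_{v}\sum_{u\ne v}\tanh(|\theta_{uv}|)\le1-\eta$ for some constant $\eta>0$. $\tilde O$ hides polylogarithmic factors in $n$. *)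

theory Defs
  imports "HOL-Probability.Probability" "HOL-Library.Ramsey" "HOL-Library.Landau_Symbols"
begin

definition spin_configs :: "'a set \<Rightarrow> ('a \<Rightarrow> real) set" where
  "spin_configs V = (V \<rightarrow>\<^sub>E {-1, 1})"

text \<open>
  A pair interaction is indexed by the two-element subsets of the vertex set, so each
  unordered pair contributes once to the exponent. This is the normalisation for which
  \<open>tanh \<bar>J {u, v}\<bar>\<close> bounds the influence of the spin at \<open>u\<close> on the one at \<open>v\<close>.
\<close>

definition ising_exponent :: "'a set \<Rightarrow> ('a \<Rightarrow> real) \<Rightarrow> ('a set \<Rightarrow> real) \<Rightarrow> ('a \<Rightarrow> real) \<Rightarrow> real" where
  "ising_exponent V h J x = (\<Sum>v\<in>V. h v * x v) + (\<Sum>e\<in>nsets V 2. J e * (\<Prod>v\<in>e. x v))"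

definition partition_function :: "'a set \<Rightarrow> ('a \<Rightarrow> real) \<Rightarrow> ('a set \<Rightarrow> real) \<Rightarrow> real" where
  "partition_function V h J = (\<Sum>x\<in>spin_configs V. exp (ising_exponent V h J x))"

definition ising :: "'a set \<Rightarrow> ('a \<Rightarrow> real) \<Rightarrow> ('a set \<Rightarrow> real) \<Rightarrow> ('a \<Rightarrow> real) pmf" where
  "ising V h J = embed_pmf (\<lambda>x. if x \<in> spin_configs V
      then exp (ising_exponent V h J x) / partition_function V h J else 0)"

lemma finite_spin_configs: "finite V \<Longrightarrow> finite (spin_configs V)"
  by (simp add: spin_configs_def finite_PiE)

lemma partition_function_pos:
  assumes "finite V"
  shows "partition_function V h J > 0"
proof -
  have "spin_configs V \<noteq> {}"
    by (simp add: spin_configs_def PiE_eq_empty_iff)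
  then show ?thesis
    unfolding partition_function_def
    by (intro sum_pos finite_spin_configs assms) auto
qed

lemma pmf_ising:
  assumes "finite V"
  shows "pmf (ising V h J) x = (if x \<in> spin_configs V
    then exp (ising_exponent V h J x) / partition_function V h J else 0)"
  unfolding ising_def
proof (rule pmf_embed_pmf)
  let ?f = "\<lambda>x. if x \<in> spin_configs V
    then exp (ising_exponent V h J x) / partition_function V h J else 0"
  have pos: "partition_function V h J > 0"
    by (rule partition_function_pos[OF assms])
  then show nonneg: "0 \<le> ?f x" for x
    by simp
  have "(\<integral>\<^sup>+x. ennreal (?f x) \<partial>count_space UNIV) = (\<Sum>x\<in>spin_configs V. ennreal (?f x))"
    by (rule nn_integral_count_space') (auto simp: finite_spin_configs assms)
  also have "\<dots> = ennreal (\<Sum>x\<in>spin_configs V. ?f x)"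
    by (rule sum_ennreal) (rule nonneg)
  also have "(\<Sum>x\<in>spin_configs V. ?f x) =
      (\<Sum>x\<in>spin_configs V. exp (ising_exponent V h J x)) / partition_function V h J"
    by (simp add: sum_divide_distrib)
  also have "\<dots> = 1"
    using pos by (simp add: partition_function_def)
  finally show "(\<integral>\<^sup>+x. ennreal (?f x) \<partial>count_space UNIV) = 1"
    by simp
qed

definition dobrushin :: "'a set \<Rightarrow> ('a set \<Rightarrow> real) \<Rightarrow> real \<Rightarrow> bool" where
  "dobrushin V J \<eta> \<longleftrightarrow> (\<forall>v\<in>V. (\<Sum>u\<in>V - {v}. tanh \<bar>J {u, v}\<bar>) \<le> 1 - \<eta>)"

definition bilinear_stat ::
    "'a set \<Rightarrow> ('a set \<Rightarrow> real) \<Rightarrow> ('a \<Rightarrow> real) \<times> ('a \<Rightarrow> real) \<Rightarrow> real" where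
  "bilinear_stat V c X = (\<Sum>e\<in>nsets V 2. c e * (\<Prod>v\<in>e. fst X v - snd X v))"

definition soft_O :: "(nat \<Rightarrow> real) \<Rightarrow> (nat \<Rightarrow> real) set" where
  "soft_O g = {f. \<exists>k::nat. f \<in> O(\<lambda>n. g n * ln (real n) ^ k)}"

end

theory Submission
  imports Defs
begin

text \<open>
  Under Dobrushin's condition the heat-bath operator contracts the total oscillation of a function
  by the factor \<open>1 - \<eta> / n\<close> per step. The squared norms of the iterates of a centred function under
  this self-adjoint operator form a log-convex sequence, so the asymptotic rate already bounds the
  first step. This spectral gap is the Poincare inequality
  \<open>\<eta> Var f \<le> (\<Sum>v. E (D v f)\<^sup>2)\<close>, where \<open>D v f\<close> is half the change of \<open>f\<close> when the spin at \<open>v\<close>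
  is flipped.

  The statistic is symmetric in its two samples, so by the Efron-Stein inequality its variance is at
  most twice the mean of its variance in the first sample alone. Its derivative there at a vertex
  is a linear statistic, centred because it depends on the difference of the two samples; hence a
  second use of the Poincare inequality bounds its second moment by \<open>2 n / \<eta>\<close>. Altogether the
  variance is at most \<open>4 n\<^sup>2 / \<eta>\<^sup>2\<close>, without logarithmic factors.
\<close>

section \<open>Pair sums, a tanh estimate and log-convex sequences\<close>

lemma sum_nsets_2_remove:
  fixes a :: "'a set \<Rightarrow> 'b::comm_monoid_add"
  assumes "finite V" "v \<in> V"
  shows "(\<Sum>e\<in>nsets V 2. a e) = (\<Sum>u\<in>V - {v}. a {u, v}) + (\<Sum>e\<in>nsets (V - {v}) 2. a e)"
proof -
  have eq: "nsets V 2 = (\<lambda>u. {u, v}) ` (V - {v}) \<union> nsets (V - {v}) 2"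
    using assms(2) by (auto simp: nsets_2_eq)
  have "inj_on (\<lambda>u. {u, v}) (V - {v})"
    by (auto simp: inj_on_def doubleton_eq_iff)
  moreover have "(\<lambda>u. {u, v}) ` (V - {v}) \<inter> nsets (V - {v}) 2 = {}"
    by (auto simp: nsets_def)
  ultimately show ?thesis
    unfolding eq using assms by (subst sum.union_disjoint) (auto simp: sum.reindex finite_imp_finite_nsets)
qed

text \<open>The difference is \<open>sinh (2 * j)\<close> over
  \<open>cosh (a + j) * cosh (a - j)\<close>, and this denominator equals
  \<open>cosh j ^ 2 + sinh a ^ 2\<close>. The worst case is thus \<open>a = 0\<close>.\<close>

lemma abs_tanh_shift_diff_le:
  fixes a j :: real
  shows "\<bar>tanh (a + j) - tanh (a - j)\<bar> \<le> 2 * tanh \<bar>j\<bar>"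
proof -
  have pos: "cosh (a + j) * cosh (a - j) > 0" "cosh j ^ 2 > 0"
    by simp_all
  have "tanh (a + j) - tanh (a - j) = (sinh (a + j) * cosh (a - j) - cosh (a + j) * sinh (a - j))
      / (cosh (a + j) * cosh (a - j))"
    by (simp add: tanh_def field_simps)
  also have "sinh (a + j) * cosh (a - j) - cosh (a + j) * sinh (a - j) = 2 * sinh j * cosh j"
    using sinh_diff[of "a + j" "a - j"] sinh_double[of j] by simp
  finally have *: "tanh (a + j) - tanh (a - j) = 2 * sinh j * cosh j / (cosh (a + j) * cosh (a - j))" .
  have "cosh (a + j) * cosh (a - j) = cosh j ^ 2 * (cosh a ^ 2 - sinh a ^ 2) + sinh a ^ 2 * (cosh j ^ 2 - sinh j ^ 2)"
    by (simp add: cosh_add cosh_diff algebra_simps power2_eq_square)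
  then have ge: "cosh j ^ 2 \<le> cosh (a + j) * cosh (a - j)"
    by (simp add: hyperbolic_pythagoras)
  have "\<bar>tanh (a + j) - tanh (a - j)\<bar> = 2 * \<bar>sinh j\<bar> * cosh j / (cosh (a + j) * cosh (a - j))"
    using pos unfolding * by (simp add: abs_mult)
  also have "\<dots> \<le> 2 * \<bar>sinh j\<bar> * cosh j / cosh j ^ 2"
    using pos ge by (intro divide_left_mono mult_nonneg_nonneg) auto
  also have "\<dots> = 2 * \<bar>tanh j\<bar>"
    by (simp add: tanh_def power2_eq_square)
  also have "\<bar>tanh j\<bar> = tanh \<bar>j\<bar>"
    by (auto simp: abs_if)
  finally show ?thesis .
qed

text \<open>The growth rate of a log-convex sequence never decreases, so the first ratio is bounded by
  the exponential growth rate.\<close>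

lemma log_convex_first_ratio_le:
  fixes b :: "nat \<Rightarrow> real"
  assumes nonneg: "\<And>t. b t \<ge> 0"
    and conv: "\<And>t. b (Suc t) ^ 2 \<le> b t * b (Suc (Suc t))"
    and bound: "\<And>t. b t \<le> C * \<rho> ^ t"
    and "\<rho> \<ge> 0"
  shows "b 1 \<le> \<rho> * b 0"
proof (rule ccontr)
  assume "\<not> ?thesis"
  then have gt: "\<rho> * b 0 < b 1" by simp
  have b0: "b 0 > 0"
    using conv[of 0] gt nonneg[of 0] by (cases "b 0 = 0") auto
  define \<kappa> where "\<kappa> = b 1 / b 0"
  have \<kappa>: "\<rho> < \<kappa>" using gt b0 by (simp add: \<kappa>_def field_simps)
  then have \<kappa>0: "\<kappa> > 0" using \<open>\<rho> \<ge> 0\<close> by linarith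
  \<comment> \<open>Positivity is part of the induction because passing to the next ratio cancels
    \<open>b t\<close>.\<close>
  have step: "b t > 0 \<and> \<kappa> * b t \<le> b (Suc t)" for t
  proof (induction t)
    case 0
    then show ?case using b0 by (simp add: \<kappa>_def)
  next
    case (Suc t)
    then have pos: "b (Suc t) > 0" using \<kappa>0
      by (smt (verit) mult_pos_pos)
    have "b t * (\<kappa> * b (Suc t)) \<le> b (Suc t) * b (Suc t)"
      using Suc pos by (simp add: mult.assoc[symmetric] mult.commute[of "b t"])
    also have "\<dots> \<le> b t * b (Suc (Suc t))"
      using conv[of t] by (simp add: power2_eq_square)
    finally show ?case using Suc pos by simp
  qed
  have low: "\<kappa> ^ t * b 0 \<le> b t" for t
  proof (induction t)
    case (Suc t)
    have "\<kappa> ^ Suc t * b 0 \<le> \<kappa> * b t" using Suc \<kappa>0 by (simp add: mult.assoc)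
    then show ?case using step[of t] by linarith
  qed simp
  show False
  proof (cases "\<rho> = 0")
    case True
    then show False using bound[of 1] step[of 1] by simp
  next
    case False
    then have "\<rho> > 0" using \<open>\<rho> \<ge> 0\<close> by simp
    then have "1 < \<kappa> / \<rho>" using \<kappa> by simp
    then obtain t where t: "C / b 0 < (\<kappa> / \<rho>) ^ t"
      using real_arch_pow by blast
    have "\<kappa> ^ t * b 0 \<le> C * \<rho> ^ t" using low[of t] bound[of t] by linarith
    then show False using t b0 \<open>\<rho> > 0\<close> by (simp add: field_simps power_divide)
  qed
qed

section \<open>Expectation as a finite weighted sum\<close>

locale ising_model =
  fixes V :: "'a set" and h :: "'a \<Rightarrow> real" and J :: "'a set \<Rightarrow> real"
  assumes finite_V: "finite V"
begin

abbreviation "S \<equiv> spin_configs V"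

definition w :: "('a \<Rightarrow> real) \<Rightarrow> real" where
  "w = pmf (ising V h J)"

definition E :: "(('a \<Rightarrow> real) \<Rightarrow> real) \<Rightarrow> real" where
  "E f = (\<Sum>x\<in>S. w x * f x)"

lemma finite_S: "finite S"
  using finite_V by (rule finite_spin_configs)

lemma w_nonneg: "w x \<ge> 0"
  by (simp add: w_def)

lemma set_pmf_ising: "set_pmf (ising V h J) \<subseteq> S"
  by (auto simp: set_pmf_eq pmf_ising finite_V)

lemma sum_w: "(\<Sum>x\<in>S. w x) = 1"
  unfolding w_def by (rule sum_pmf_eq_1[OF finite_S set_pmf_ising])

lemma expectation_ising: "measure_pmf.expectation (ising V h J) f = E f"
  unfolding E_def w_def
  by (subst integral_measure_pmf_real[OF finite_S]) (use set_pmf_ising in \<open>auto simp: mult.commute\<close>)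

lemma E_const: "E (\<lambda>x. c) = c"
  by (simp add: E_def sum_w flip: sum_distrib_right)

lemma E_add: "E (\<lambda>x. f x + g x) = E f + E g"
  by (simp add: E_def distrib_left sum.distrib)

lemma E_diff: "E (\<lambda>x. f x - g x) = E f - E g"
  by (simp add: E_def right_diff_distrib sum_subtractf)

lemma E_cmult: "E (\<lambda>x. c * f x) = c * E f"
  by (simp add: E_def sum_distrib_left mult.left_commute)

lemma E_sum: "E (\<lambda>x. \<Sum>i\<in>I. f i x) = (\<Sum>i\<in>I. E (f i))"
  unfolding E_def by (simp add: sum_distrib_left) (rule sum.swap)

lemma E_mono: "(\<And>x. x \<in> S \<Longrightarrow> f x \<le> g x) \<Longrightarrow> E f \<le> E g"
  unfolding E_def by (intro sum_mono mult_left_mono w_nonneg)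

lemma E_cong: "(\<And>x. x \<in> S \<Longrightarrow> f x = g x) \<Longrightarrow> E f = E g"
  unfolding E_def by (intro sum.cong) auto

lemma E_nonneg: "(\<And>x. x \<in> S \<Longrightarrow> 0 \<le> f x) \<Longrightarrow> 0 \<le> E f"
  unfolding E_def by (intro sum_nonneg mult_nonneg_nonneg w_nonneg)

lemma E_swap: "E (\<lambda>x. E (\<lambda>y. f x y)) = E (\<lambda>y. E (\<lambda>x. f x y))"
  unfolding E_def by (simp add: sum_distrib_left) (subst sum.swap, simp add: mult.left_commute)

lemma E_Cauchy_Schwarz: "E (\<lambda>x. f x * g x) ^ 2 \<le> E (\<lambda>x. f x ^ 2) * E (\<lambda>x. g x ^ 2)"
proof -
  have "(\<Sum>x\<in>S. (sqrt (w x) * f x) * (sqrt (w x) * g x)) ^ 2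
      \<le> (\<Sum>x\<in>S. (sqrt (w x) * f x) ^ 2) * (\<Sum>x\<in>S. (sqrt (w x) * g x) ^ 2)"
    by (rule Cauchy_Schwarz_ineq_sum)
  moreover have "(sqrt (w x) * a) * (sqrt (w x) * b) = w x * (a * b)" for x a b
    using w_nonneg[of x] by (simp add: mult.left_commute mult.assoc flip: mult.assoc[of "sqrt (w x)"])
  ultimately show ?thesis
    unfolding E_def by (simp add: power_mult_distrib w_nonneg)
qed

lemma E_square_le: "E f ^ 2 \<le> E (\<lambda>x. f x ^ 2)"
  using E_Cauchy_Schwarz[of f "\<lambda>_. 1"] by (simp add: E_const)

section \<open>Single-site conditional laws\<close>

lemma upd_mem: "x \<in> S \<Longrightarrow> v \<in> V \<Longrightarrow> s \<in> {-1, 1} \<Longrightarrow> x(v := s) \<in> S"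
  by (auto simp: spin_configs_def PiE_iff extensional_def)

lemma spin_cases:
  assumes "x \<in> S" "v \<in> V"
  obtains "x v = 1" "x(v := 1) = x" | "x v = -1" "x(v := -1) = x"
  using assms by (metis PiE_mem fun_upd_triv insertE singletonD spin_configs_def)

text \<open>Flipping the spin at \<open>v\<close> is an involution of \<open>S\<close>. The half
  appears because each flip pair is counted from both of its members.\<close>

lemma sum_spins_at:
  fixes F :: "('a \<Rightarrow> real) \<Rightarrow> real"
  assumes "v \<in> V"
  shows "(\<Sum>x\<in>S. F x) = (\<Sum>x\<in>S. F (x(v := 1)) + F (x(v := -1))) / 2"
proof -
  let ?flip = "\<lambda>x::'a \<Rightarrow> real. x(v := - x v)"
  have "?flip x \<in> S" if "x \<in> S" for x
  proof -
    have "- x v \<in> {-1, 1}"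
      by (rule spin_cases[OF that assms]) auto
    then show ?thesis by (rule upd_mem[OF that assms])
  qed
  then have "bij_betw ?flip S S"
    by (intro bij_betwI[of _ _ _ ?flip]) auto
  then have "(\<Sum>x\<in>S. F (?flip x)) = (\<Sum>x\<in>S. F x)"
    by (rule sum.reindex_bij_betw)
  moreover have "(\<Sum>x\<in>S. F (x(v := 1)) + F (x(v := -1))) = (\<Sum>x\<in>S. F x + F (?flip x))"
  proof (rule sum.cong)
    fix x assume "x \<in> S"
    then show "F (x(v := 1)) + F (x(v := -1)) = F x + F (?flip x)"
      using assms by (cases rule: spin_cases[of x v]) auto
  qed simp
  ultimately show ?thesis by (simp add: sum.distrib)
qed

text \<open>The local field: the coefficient of the spin at \<open>v\<close> in the exponent, itself
  independent of that spin.\<close>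

definition field :: "'a \<Rightarrow> ('a \<Rightarrow> real) \<Rightarrow> real" where
  "field v x = h v + (\<Sum>u\<in>V - {v}. J {u, v} * x u)"

text \<open>\<open>plus_prob v x\<close> is the conditional probability of spin \<open>+1\<close> at \<open>v\<close> given the other
  spins of \<open>x\<close>, and \<open>resample v f\<close> the conditional expectation of \<open>f\<close>.\<close>

definition plus_prob :: "'a \<Rightarrow> ('a \<Rightarrow> real) \<Rightarrow> real" where
  "plus_prob v x = (1 + tanh (field v x)) / 2"

definition resample :: "'a \<Rightarrow> (('a \<Rightarrow> real) \<Rightarrow> real) \<Rightarrow> ('a \<Rightarrow> real) \<Rightarrow> real" where
  "resample v f x = plus_prob v x * f (x(v := 1)) + (1 - plus_prob v x) * f (x(v := -1))"

lemma plus_prob_bounds: "0 \<le> plus_prob v x" "plus_prob v x \<le> 1"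
  using tanh_real_bounds[of "field v x"] by (auto simp: plus_prob_def)

lemma field_upd_same [simp]: "field v (x(v := s)) = field v x"
  by (auto simp: field_def intro!: sum.cong)

lemma plus_prob_upd_same [simp]: "plus_prob v (x(v := s)) = plus_prob v x"
  by (simp add: plus_prob_def)

lemma resample_upd_same [simp]: "resample v f (x(v := s)) = resample v f x"
  by (simp add: resample_def)

lemma ising_exponent_upd:
  assumes "v \<in> V"
  shows "ising_exponent V h J (x(v := s)) = s * field v x + ising_exponent (V - {v}) h J x"
proof -
  have "(\<Sum>u\<in>V. h u * (x(v := s)) u) = h v * s + (\<Sum>u\<in>V - {v}. h u * x u)"
    using assms finite_V by (subst sum.remove[of V v]) auto
  moreover have "(\<Sum>e\<in>nsets V 2. J e * (\<Prod>u\<in>e. (x(v := s)) u))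
      = (\<Sum>u\<in>V - {v}. J {u, v} * (x u * s)) + (\<Sum>e\<in>nsets (V - {v}) 2. J e * (\<Prod>u\<in>e. x u))"
    by (subst sum_nsets_2_remove[OF finite_V assms])
      (auto intro!: arg_cong2[where f = "(+)"] sum.cong prod.cong simp: nsets_def subset_iff)
  ultimately show ?thesis
    by (simp add: ising_exponent_def field_def sum_distrib_left algebra_simps)
qed

text \<open>The part of the exponent without \<open>v\<close> cancels, so the two weights are in
  ratio \<open>exp (field v x)\<close> to \<open>exp (- field v x)\<close>; normalising gives
  \<open>(1 + tanh (field v x)) / 2\<close>.\<close>

lemma w_upd:
  assumes "x \<in> S" "v \<in> V"
  shows "w (x(v := 1)) = plus_prob v x * (w (x(v := 1)) + w (x(v := -1)))"
    "w (x(v := -1)) = (1 - plus_prob v x) * (w (x(v := 1)) + w (x(v := -1)))"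
proof -
  define Z where "Z = exp (ising_exponent (V - {v}) h J x) / partition_function V h J"
  have wp: "w (x(v := 1)) = exp (field v x) * Z" "w (x(v := -1)) = exp (- field v x) * Z"
    using upd_mem[OF assms, of 1] upd_mem[OF assms, of "-1"] ising_exponent_upd[OF assms(2), of x 1]
      ising_exponent_upd[OF assms(2), of x "-1"]
    by (simp_all add: w_def Z_def pmf_ising finite_V mult_exp_exp)
  have "exp (field v x) + exp (- field v x) > 0" by (intro add_pos_pos) auto
  then have "plus_prob v x = exp (field v x) / (exp (field v x) + exp (- field v x))"
    by (simp add: plus_prob_def tanh_altdef field_simps)
  then have pp: "plus_prob v x * (exp (field v x) + exp (- field v x)) = exp (field v x)"
    using \<open>exp (field v x) + exp (- field v x) > 0\<close> by simp
  show "w (x(v := 1)) = plus_prob v x * (w (x(v := 1)) + w (x(v := -1)))"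
    unfolding wp by (simp add: pp flip: distrib_right mult.assoc)
  then show "w (x(v := -1)) = (1 - plus_prob v x) * (w (x(v := 1)) + w (x(v := -1)))"
    by (simp add: algebra_simps)
qed

text \<open>The tower property, in a form that lets expectations be compared after conditioning on
  all spins but the one at \<open>v\<close>.\<close>

lemma E_resample_at:
  assumes "v \<in> V"
  shows "E f = (\<Sum>x\<in>S. (w (x(v := 1)) + w (x(v := -1))) * resample v f x) / 2"
proof -
  have "w (x(v := 1)) * f (x(v := 1)) + w (x(v := -1)) * f (x(v := -1))
      = (w (x(v := 1)) + w (x(v := -1))) * resample v f x" if "x \<in> S" for x
  proof -
    define W where "W = w (x(v := 1)) + w (x(v := -1))"
    note eqs = w_upd[OF that assms, folded W_def]
    show ?thesis
      unfolding W_def[symmetric] eqs by (simp add: resample_def algebra_simps)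
  qed
  then show ?thesis
    unfolding E_def by (subst sum_spins_at[OF assms]) simp
qed

lemma resample_resample_mult:
  "resample v (\<lambda>x. g x * resample v f x) x = resample v g x * resample v f x"
  unfolding resample_def[of v "\<lambda>x. g x * resample v f x"] resample_upd_same
  by (simp add: resample_def[of v g] algebra_simps)

text \<open>A resampled function does not depend on the spin at \<open>v\<close>, so conditioning
  turns both sides into the product of \<open>resample v g\<close> and
  \<open>resample v f\<close>.\<close>

lemma E_resample_self_adjoint:
  assumes "v \<in> V"
  shows "E (\<lambda>x. g x * resample v f x) = E (\<lambda>x. resample v g x * f x)"
proof -
  have "E (\<lambda>x. g x * resample v f x) = E (\<lambda>x. f x * resample v g x)"
    unfolding E_resample_at[OF assms] resample_resample_mult by (simp add: mult.commute)
  then show ?thesis by (simp add: mult.commute)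
qed

text \<open>Given the other spins, the left side is the variance of a two-point law,
  \<open>q * (1 - q) * (a - b) ^ 2\<close>, and \<open>q * (1 - q) \<le> 1 / 4\<close>.\<close>

lemma E_Dirichlet_le:
  assumes "v \<in> V"
  shows "E (\<lambda>x. f x * (f x - resample v f x)) \<le> E (\<lambda>x. ((f (x(v := 1)) - f (x(v := -1))) / 2) ^ 2)"
  unfolding E_resample_at[OF assms]
proof (intro divide_right_mono sum_mono mult_left_mono add_nonneg_nonneg w_nonneg)
  fix x
  define q a b where "q = plus_prob v x" and "a = f (x(v := 1))" and "b = f (x(v := -1))"
  have "resample v (\<lambda>x. f x * (f x - resample v f x)) x = q * (1 - q) * (a - b) ^ 2"
    by (simp add: resample_def q_def a_def b_def algebra_simps power2_eq_square)
  also have "\<dots> \<le> (1 / 4) * (a - b) ^ 2"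
    using sum_squares_ge_zero[of "q - 1/2" 0]
    by (intro mult_right_mono) (auto simp: algebra_simps)
  also have "\<dots> = resample v (\<lambda>x. ((f (x(v := 1)) - f (x(v := -1))) / 2) ^ 2) x"
    by (simp add: resample_def a_def b_def power_divide flip: distrib_right add_divide_distrib)
  finally show "resample v (\<lambda>x. f x * (f x - resample v f x)) x
      \<le> resample v (\<lambda>x. ((f (x(v := 1)) - f (x(v := -1))) / 2) ^ 2) x" .
qed simp

section \<open>Oscillations and their contraction\<close>

text \<open>\<open>d\<close> is any majorant of the oscillations rather than their exact maxima, so
  bounds pass through operators without computing suprema.\<close>

definition osc_le :: "(('a \<Rightarrow> real) \<Rightarrow> real) \<Rightarrow> ('a \<Rightarrow> real) \<Rightarrow> bool" where
  "osc_le f d \<longleftrightarrow> (\<forall>v\<in>V. 0 \<le> d v \<and> (\<forall>x\<in>S. \<bar>f (x(v := 1)) - f (x(v := -1))\<bar> \<le> d v))"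

text \<open>A crude majorant suffices: it only enters the constant of an exponential bound whose
  rate alone is used.\<close>

lemma osc_le_exists: "\<exists>d. osc_le f d"
proof -
  define d where "d v = (\<Sum>x\<in>S. \<bar>f (x(v := 1)) - f (x(v := -1))\<bar>)" for v
  have "osc_le f d"
    unfolding osc_le_def d_def
    by (auto intro!: sum_nonneg member_le_sum finite_S)
  then show ?thesis by blast
qed

text \<open>Turn \<open>y\<close> into \<open>x\<close> one vertex at a time; changing the vertex
  \<open>a\<close> costs at most \<open>d a\<close>.\<close>

lemma osc_le_diff_le_sum:
  assumes "osc_le f d" "x \<in> S" "y \<in> S"
  shows "\<bar>f x - f y\<bar> \<le> sum d V"
proof -
  have "\<bar>f (\<lambda>v. if v \<in> A then x v else y v) - f y\<bar> \<le> sum d A" if "A \<subseteq> V" "finite A" for A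
    using that(2,1)
  proof (induction A)
    case empty
    then show ?case by simp
  next
    case (insert a A)
    define z where "z = (\<lambda>v. if v \<in> A then x v else y v)"
    have a: "a \<in> V" "a \<notin> A" using insert by auto
    have zS: "z \<in> S" using assms(2,3)
      by (auto simp: z_def spin_configs_def PiE_iff extensional_def)
    have upd: "(\<lambda>v. if v \<in> insert a A then x v else y v) = z(a := x a)"
      by (auto simp: z_def)
    have "\<bar>f (z(a := x a)) - f z\<bar> \<le> d a"
      using spin_cases[OF zS a(1)] spin_cases[OF assms(2) a(1)] assms(1) a(1) zS
      unfolding osc_le_def by (smt (verit, best))
    moreover have "\<bar>f z - f y\<bar> \<le> sum d A" using insert by (simp add: z_def)
    ultimately show ?case unfolding upd using insert a by simp
  qed
  from this[OF subset_refl finite_V] have "\<bar>f (\<lambda>v. if v \<in> V then x v else y v) - f y\<bar> \<le> sum d V" .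
  moreover have "(\<lambda>v. if v \<in> V then x v else y v) = x"
    using assms(2,3) by (auto simp: spin_configs_def PiE_iff extensional_def fun_eq_iff)
  ultimately show ?thesis by simp
qed

text \<open>For centred \<open>f\<close>, the value \<open>f x\<close> is the mean of
  \<open>f x - f y\<close> over \<open>y\<close>, hence bounded by the total oscillation.\<close>

lemma E_square_le_osc:
  assumes "osc_le f d" "E f = 0"
  shows "E (\<lambda>x. f x ^ 2) \<le> (sum d V) ^ 2"
proof -
  have "\<bar>f x\<bar> \<le> \<bar>sum d V\<bar>" if "x \<in> S" for x
  proof -
    have "E (\<lambda>y. f x - f y) \<le> E (\<lambda>y. sum d V)" "E (\<lambda>y. f y - f x) \<le> E (\<lambda>y. sum d V)"
      by (rule E_mono, use osc_le_diff_le_sum[OF assms(1) that] in \<open>fastforce simp: abs_le_iff\<close>)+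
    then show ?thesis by (simp add: E_diff E_const assms(2))
  qed
  then have "E (\<lambda>x. f x ^ 2) \<le> E (\<lambda>x. (sum d V) ^ 2)"
    by (intro E_mono) (simp add: abs_le_square_iff)
  then show ?thesis by (simp add: E_const)
qed

lemma field_upd_other:
  assumes "u \<in> V" "u \<noteq> v"
  shows "field v (x(u := s)) = field v (x(u := 0)) + s * J {u, v}"
proof -
  have "u \<in> V - {v}" using assms by simp
  then show ?thesis
    unfolding field_def using finite_V
    by (simp add: sum.remove[of "V - {v}" u] mult.commute)
qed

text \<open>Putting 0 at \<open>u\<close> isolates the field of the other vertices: the two fields
  are \<open>a + j\<close> and \<open>a - j\<close> with \<open>j = J {u, v}\<close>. The half in
  \<open>plus_prob\<close> absorbs the 2 of the tanh estimate.\<close>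

lemma plus_prob_influence:
  assumes "u \<in> V" "u \<noteq> v"
  shows "\<bar>plus_prob v (x(u := 1)) - plus_prob v (x(u := -1))\<bar> \<le> tanh \<bar>J {u, v}\<bar>"
  using abs_tanh_shift_diff_le[of "field v (x(u := 0))" "J {u, v}"]
  by (simp add: plus_prob_def field_upd_other[OF assms, of x 1] field_upd_other[OF assms, of x "-1"]
      abs_le_iff field_simps)

text \<open>Resampling erases the dependence on the spin at \<open>v\<close>. A change at
  \<open>u\<close> acts directly, by at most \<open>d u\<close>, and through the law of the new spin
  at \<open>v\<close>, at a cost of at most the influence times \<open>d v\<close>.\<close>

lemma osc_le_resample:
  assumes "osc_le f d" "v \<in> V"
  shows "osc_le (resample v f) (\<lambda>u. if u = v then 0 else d u + tanh \<bar>J {u, v}\<bar> * d v)"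
  unfolding osc_le_def
proof (intro ballI conjI)
  fix u assume u: "u \<in> V"
  show "0 \<le> (if u = v then 0 else d u + tanh \<bar>J {u, v}\<bar> * d v)"
    using assms u by (auto simp: osc_le_def)
  fix x assume x: "x \<in> S"
  show "\<bar>resample v f (x(u := 1)) - resample v f (x(u := -1))\<bar>
      \<le> (if u = v then 0 else d u + tanh \<bar>J {u, v}\<bar> * d v)"
  proof (cases "u = v")
    case False
    define a b where "a = plus_prob v (x(u := 1))" and "b = plus_prob v (x(u := -1))"
    define F where "F s t = f (x(v := s, u := t))" for s t
    have swap: "x(u := t, v := s) = x(v := s, u := t)" for s t
      using False by (simp add: fun_upd_twist)
    \<comment> \<open>First the spin at \<open>u\<close> changes with the resampling probability
      kept at \<open>a\<close>; then the probability moves from \<open>a\<close> to \<open>b\<close>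
      with the spin at \<open>u\<close> kept at -1.\<close>
    have "resample v f (x(u := 1)) - resample v f (x(u := -1))
        = a * (F 1 1 - F 1 (-1)) + (1 - a) * (F (-1) 1 - F (-1) (-1)) + (a - b) * (F 1 (-1) - F (-1) (-1))"
      by (simp add: resample_def a_def b_def F_def swap algebra_simps)
    also have "\<bar>\<dots>\<bar> \<le> a * d u + (1 - a) * d u + tanh \<bar>J {u, v}\<bar> * d v"
    proof (intro order_trans[OF abs_triangle_ineq] add_mono)
      have ab: "0 \<le> a" "a \<le> 1" "\<bar>a - b\<bar> \<le> tanh \<bar>J {u, v}\<bar>"
        using plus_prob_bounds plus_prob_influence[OF u False] by (auto simp: a_def b_def)
      have Fu: "\<bar>F s 1 - F s (-1)\<bar> \<le> d u" if "s \<in> {-1, 1}" for s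
        using assms u upd_mem[OF x assms(2) that] unfolding osc_le_def F_def by blast
      have "\<bar>f (x(u := -1, v := 1)) - f (x(u := -1, v := -1))\<bar> \<le> d v"
        using assms upd_mem[OF x u, of "-1"] unfolding osc_le_def by blast
      then have Fv: "\<bar>F 1 (-1) - F (-1) (-1)\<bar> \<le> d v"
        unfolding F_def swap .
      show "\<bar>a * (F 1 1 - F 1 (-1))\<bar> \<le> a * d u" "\<bar>(1 - a) * (F (-1) 1 - F (-1) (-1))\<bar> \<le> (1 - a) * d u"
        using ab Fu by (auto simp: abs_mult intro!: mult_left_mono)
      show "\<bar>(a - b) * (F 1 (-1) - F (-1) (-1))\<bar> \<le> tanh \<bar>J {u, v}\<bar> * d v"
        unfolding abs_mult by (rule mult_mono) (use ab Fv in auto)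
    qed
    finally show ?thesis using False by (simp add: algebra_simps)
  qed simp
qed

text \<open>The unnormalised heat-bath operator: summing instead of averaging over the vertices avoids
  division by \<open>card V\<close>.\<close>

definition glauber :: "(('a \<Rightarrow> real) \<Rightarrow> real) \<Rightarrow> ('a \<Rightarrow> real) \<Rightarrow> real" where
  "glauber f x = (\<Sum>v\<in>V. resample v f x)"

lemma E_glauber_self_adjoint: "E (\<lambda>x. g x * glauber f x) = E (\<lambda>x. glauber g x * f x)"
  by (simp add: glauber_def sum_distrib_left sum_distrib_right E_sum E_resample_self_adjoint)

text \<open>Constants are eigenfunctions with eigenvalue \<open>card V\<close>. In particular,
  centred functions stay centred under iteration.\<close>

lemma E_glauber: "E (glauber f) = real (card V) * E f"
proof -
  have "glauber (\<lambda>_. 1) = (\<lambda>_. real (card V))"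
    by (simp add: glauber_def resample_def fun_eq_iff)
  then show ?thesis
    using E_glauber_self_adjoint[of "\<lambda>_. 1" f] by (simp add: E_cmult)
qed

text \<open>Resampling \<open>v\<close> removes \<open>d v\<close> from the total and, by
  Dobrushin's condition, passes on at most \<open>(1 - \<eta>) * d v\<close> to the other vertices:
  a net loss of at least \<open>\<eta> * d v\<close>, summed over \<open>v\<close>.\<close>

lemma osc_le_glauber:
  assumes "osc_le f d" "dobrushin V J \<eta>"
  shows "\<exists>d'. osc_le (glauber f) d' \<and> sum d' V \<le> (real (card V) - \<eta>) * sum d V"
proof (intro exI conjI)
  let ?r = "\<lambda>v u. if u = v then 0 else d u + tanh \<bar>J {u, v}\<bar> * d v"
  have r: "osc_le (resample v f) (?r v)" if "v \<in> V" for v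
    using osc_le_resample[OF assms(1) that] .
  show "osc_le (glauber f) (\<lambda>u. \<Sum>v\<in>V. ?r v u)"
    unfolding osc_le_def
  proof (intro ballI conjI)
    fix u assume u: "u \<in> V"
    show "0 \<le> (\<Sum>v\<in>V. ?r v u)"
      by (rule sum_nonneg) (use r u in \<open>auto simp: osc_le_def\<close>)
    fix x assume x: "x \<in> S"
    have "\<bar>glauber f (x(u := 1)) - glauber f (x(u := -1))\<bar>
        \<le> (\<Sum>v\<in>V. \<bar>resample v f (x(u := 1)) - resample v f (x(u := -1))\<bar>)"
      unfolding glauber_def sum_subtractf[symmetric] by (rule sum_abs)
    also have "\<dots> \<le> (\<Sum>v\<in>V. ?r v u)"
      using r u x unfolding osc_le_def by (intro sum_mono) blast
    finally show "\<bar>glauber f (x(u := 1)) - glauber f (x(u := -1))\<bar> \<le> (\<Sum>v\<in>V. ?r v u)" .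
  qed
  have "(\<Sum>u\<in>V. ?r v u) \<le> sum d V - \<eta> * d v" if v: "v \<in> V" for v
  proof -
    have "(\<Sum>u\<in>V. ?r v u) = (\<Sum>u\<in>V - {v}. d u) + (\<Sum>u\<in>V - {v}. tanh \<bar>J {u, v}\<bar>) * d v"
      using v finite_V by (subst sum.remove[of V v]) (auto simp: sum.distrib sum_distrib_right)
    also have "\<dots> \<le> (\<Sum>u\<in>V - {v}. d u) + (1 - \<eta>) * d v"
      using assms v by (intro add_left_mono mult_right_mono) (auto simp: dobrushin_def osc_le_def)
    also have "\<dots> = sum d V - \<eta> * d v"
      using v finite_V by (simp add: sum.remove[of V v d] algebra_simps)
    finally show ?thesis .
  qed
  then have "(\<Sum>v\<in>V. \<Sum>u\<in>V. ?r v u) \<le> (\<Sum>v\<in>V. sum d V - \<eta> * d v)"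
    by (intro sum_mono) auto
  also have "\<dots> = (real (card V) - \<eta>) * sum d V"
    by (simp add: sum_subtractf algebra_simps flip: sum_distrib_left)
  finally show "(\<Sum>u\<in>V. \<Sum>v\<in>V. ?r v u) \<le> (real (card V) - \<eta>) * sum d V"
    by (subst sum.swap)
qed

section \<open>Spectral gap and Poincare inequality\<close>

text \<open>Contraction of oscillations controls the norms of the iterates only up to a constant;
  log-convexity removes it. The second claim makes the rate nonnegative.\<close>

lemma E_glauber_square_le:
  assumes "dobrushin V J \<eta>" "\<eta> > 0" "V \<noteq> {}" "E f = 0"
  shows "E (\<lambda>x. glauber f x ^ 2) \<le> (real (card V) - \<eta>) ^ 2 * E (\<lambda>x. f x ^ 2)"
    and "\<eta> \<le> real (card V)"
proof -
  \<comment> \<open>A sum of nonnegative influences is at most \<open>1 - \<eta>\<close>, whence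
    \<open>\<eta> \<le> 1 \<le> card V\<close>.\<close>
  obtain v where "v \<in> V" using assms by auto
  then have "(\<Sum>u\<in>V - {v}. tanh \<bar>J {u, v}\<bar>) \<le> 1 - \<eta>" using assms by (auto simp: dobrushin_def)
  moreover have "0 \<le> (\<Sum>u\<in>V - {v}. tanh \<bar>J {u, v}\<bar>)" by (intro sum_nonneg) auto
  moreover have "1 \<le> card V" using assms finite_V by (simp add: Suc_le_eq card_gt_0_iff)
  ultimately show n: "\<eta> \<le> real (card V)" by linarith
  obtain d where d: "osc_le f d" using osc_le_exists by blast
  define \<rho> where "\<rho> = real (card V) - \<eta>"
  have \<rho>: "0 \<le> \<rho>" using n by (simp add: \<rho>_def)
  define g where "g t = (glauber ^^ t) f" for t
  define b where "b t = E (\<lambda>x. g t x ^ 2)" for t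
  have g0: "E (g t) = 0" for t
    by (induction t) (auto simp: g_def E_glauber assms(4))
  have osc: "\<exists>d'. osc_le (g t) d' \<and> sum d' V \<le> \<rho> ^ t * sum d V" for t
  proof (induction t)
    case 0
    then show ?case using d by (auto simp: g_def)
  next
    case (Suc t)
    then obtain d' where d': "osc_le (g t) d'" "sum d' V \<le> \<rho> ^ t * sum d V" by blast
    obtain d'' where d'': "osc_le (g (Suc t)) d''" "sum d'' V \<le> \<rho> * sum d' V"
      using osc_le_glauber[OF d'(1) assms(1)] by (auto simp: g_def \<rho>_def)
    have "\<rho> * sum d' V \<le> \<rho> ^ Suc t * sum d V"
      using mult_left_mono[OF d'(2) \<rho>] by (simp add: mult.assoc)
    then show ?case using d'' by fastforce
  qed
  have bound: "b t \<le> (sum d V) ^ 2 * (\<rho> ^ 2) ^ t" for t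
  proof -
    obtain d' where d': "osc_le (g t) d'" "sum d' V \<le> \<rho> ^ t * sum d V" using osc by blast
    have "0 \<le> sum d' V" using d'(1) by (auto simp: osc_le_def intro: sum_nonneg)
    then have "(sum d' V) ^ 2 \<le> (\<rho> ^ t * sum d V) ^ 2" using d'(2) by (intro power_mono) auto
    moreover have "b t \<le> (sum d' V) ^ 2" unfolding b_def by (rule E_square_le_osc[OF d'(1) g0])
    ultimately show ?thesis by (simp add: power_mult_distrib mult.commute flip: power_mult)
  qed
  have conv: "b (Suc t) ^ 2 \<le> b t * b (Suc (Suc t))" for t
  proof -
    \<comment> \<open>Self-adjointness moves one application of \<open>glauber\<close> to the other
      factor, which makes Cauchy-Schwarz yield log-convexity.\<close>
    have "b (Suc t) = E (\<lambda>x. g t x * g (Suc (Suc t)) x)"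
      using E_glauber_self_adjoint[of "g t" "g (Suc t)"]
      by (simp add: b_def g_def power2_eq_square)
    then show ?thesis unfolding b_def by (simp add: E_Cauchy_Schwarz)
  qed
  have "b 1 \<le> \<rho> ^ 2 * b 0"
    by (rule log_convex_first_ratio_le[OF _ conv bound]) (auto simp: b_def intro: E_nonneg)
  then show "E (\<lambda>x. glauber f x ^ 2) \<le> (real (card V) - \<eta>) ^ 2 * E (\<lambda>x. f x ^ 2)"
    by (simp add: b_def g_def \<rho>_def)
qed

text \<open>Cauchy-Schwarz turns the norm bound on \<open>glauber f\<close> into a bound on its
  inner product with \<open>f\<close>. Subtracting this from \<open>card V\<close> times the squared
  norm leaves \<open>\<eta>\<close> times the squared norm as a lower bound for the Dirichlet
  form.\<close>

lemma poincare_centered: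
  assumes "dobrushin V J \<eta>" "\<eta> > 0" "E f = 0"
  shows "\<eta> * E (\<lambda>x. f x ^ 2) \<le> (\<Sum>v\<in>V. E (\<lambda>x. ((f (x(v := 1)) - f (x(v := -1))) / 2) ^ 2))"
proof (cases "V = {}")
  case True
  then have "osc_le f (\<lambda>_. 0)" unfolding osc_le_def by simp
  from E_square_le_osc[OF this assms(3)] have "E (\<lambda>x. f x ^ 2) \<le> 0" by simp
  then show ?thesis using True assms(2) by (simp add: mult_nonneg_nonpos)
next
  case False
  note G = E_glauber_square_le[OF assms(1,2) False assms(3)]
  define F where "F = E (\<lambda>x. f x ^ 2)"
  have F: "0 \<le> F" by (auto simp: F_def intro: E_nonneg)
  have "E (\<lambda>x. f x * glauber f x) ^ 2 \<le> F * E (\<lambda>x. glauber f x ^ 2)"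
    unfolding F_def by (rule E_Cauchy_Schwarz)
  also have "\<dots> \<le> F * ((real (card V) - \<eta>) ^ 2 * F)"
    using G(1) F unfolding F_def by (rule mult_left_mono)
  also have "\<dots> = ((real (card V) - \<eta>) * F) ^ 2"
    by (simp add: power2_eq_square)
  finally have "E (\<lambda>x. f x * glauber f x) \<le> (real (card V) - \<eta>) * F"
    by (rule power2_le_imp_le) (use G(2) F in \<open>intro mult_nonneg_nonneg; simp\<close>)
  moreover have "(\<Sum>v\<in>V. E (\<lambda>x. f x * (f x - resample v f x))) = real (card V) * F - E (\<lambda>x. f x * glauber f x)"
    by (simp add: glauber_def right_diff_distrib sum_distrib_left E_sum E_diff sum_subtractf F_def power2_eq_square)
  moreover have "(\<Sum>v\<in>V. E (\<lambda>x. f x * (f x - resample v f x)))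
      \<le> (\<Sum>v\<in>V. E (\<lambda>x. ((f (x(v := 1)) - f (x(v := -1))) / 2) ^ 2))"
    by (intro sum_mono E_Dirichlet_le)
  ultimately show ?thesis unfolding F_def[symmetric] by (simp add: algebra_simps)
qed

lemma poincare:
  assumes "dobrushin V J \<eta>" "\<eta> > 0"
  shows "E (\<lambda>x. (f x - E f) ^ 2) \<le> (\<Sum>v\<in>V. E (\<lambda>x. ((f (x(v := 1)) - f (x(v := -1))) / 2) ^ 2)) / \<eta>"
  using poincare_centered[OF assms, of "\<lambda>x. f x - E f"] assms(2)
  by (simp add: E_diff E_const pos_le_divide_eq mult.commute)

section \<open>Variance of the two-sample statistic\<close>

lemma expectation_pair:
  "measure_pmf.expectation (pair_pmf (ising V h J) (ising V h J)) G = E (\<lambda>x. E (\<lambda>y. G (x, y)))"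
proof -
  have "measure_pmf.expectation (pair_pmf (ising V h J) (ising V h J)) G
      = (\<Sum>z\<in>S \<times> S. G z * pmf (pair_pmf (ising V h J) (ising V h J)) z)"
    by (rule integral_measure_pmf_real) (use set_pmf_ising finite_S in auto)
  also have "\<dots> = E (\<lambda>x. E (\<lambda>y. G (x, y)))"
    unfolding E_def w_def sum_distrib_left sum.cartesian_product
    by (rule sum.cong) (auto simp: pmf_pair mult_ac)
  finally show ?thesis .
qed

lemma E_square_decomp: "E (\<lambda>x. (f x - a) ^ 2) = E (\<lambda>x. (f x - E f) ^ 2) + (E f - a) ^ 2"
proof -
  have "E (\<lambda>x. (f x - a) ^ 2) = E (\<lambda>x. (f x - E f) ^ 2 + (2 * (E f - a) * (f x - E f) + (E f - a) ^ 2))"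
    by (intro E_cong) (simp add: power2_eq_square algebra_simps)
  also have "\<dots> = E (\<lambda>x. (f x - E f) ^ 2) + (2 * (E f - a) * (E f - E f) + (E f - a) ^ 2)"
    by (simp only: E_add E_cmult E_diff E_const)
  finally show ?thesis by simp
qed

text \<open>Conditioning on the second sample splits the variance into the mean conditional variance
  and the variance of the conditional mean. By symmetry, the latter is at most the former.\<close>

lemma variance_symmetric_le:
  assumes sym: "\<And>x y. G (x, y) = G (y, x)"
  shows "measure_pmf.variance (pair_pmf (ising V h J) (ising V h J)) G
    \<le> 2 * E (\<lambda>y. E (\<lambda>x. (G (x, y) - E (\<lambda>x. G (x, y))) ^ 2))"
proof -
  define k where "k y = E (\<lambda>x. G (x, y))" for y
  have k': "E (\<lambda>y. G (x, y)) = k x" for x unfolding k_def by (simp add: sym[of x])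
  define W where "W = E (\<lambda>y. E (\<lambda>x. (G (x, y) - k y) ^ 2))"
  have "measure_pmf.variance (pair_pmf (ising V h J) (ising V h J)) G
      = E (\<lambda>y. E (\<lambda>x. (G (x, y) - E k) ^ 2))"
    unfolding expectation_pair k' by (rule E_swap)
  also have "\<dots> = E (\<lambda>y. E (\<lambda>x. (G (x, y) - k y) ^ 2) + (k y - E k) ^ 2)"
    unfolding k_def by (subst E_square_decomp) simp
  also have "\<dots> = W + E (\<lambda>y. (k y - E k) ^ 2)"
    by (simp add: E_add W_def)
  also have "E (\<lambda>y. (k y - E k) ^ 2) \<le> E (\<lambda>y. E (\<lambda>x. (G (x, y) - k x) ^ 2))"
  proof (rule E_mono)
    fix y
    \<comment> \<open>The deviation of the conditional mean is itself a mean over \<open>x\<close>,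
      so its square is at most the mean square.\<close>
    have "k y - E k = E (\<lambda>x. G (x, y) - k x)" by (simp add: E_diff k_def[of y])
    then show "(k y - E k) ^ 2 \<le> E (\<lambda>x. (G (x, y) - k x) ^ 2)" by (simp add: E_square_le)
  qed
  also have "E (\<lambda>y. E (\<lambda>x. (G (x, y) - k x) ^ 2)) = W"
    unfolding W_def by (subst E_swap) (simp add: sym)
  finally show ?thesis by (simp add: W_def k_def)
qed

text \<open>The difference of two independent copies cancels the mean caused by the external field,
  so the left side is twice the variance of one copy. The discrete derivatives of that copy are
  \<open>a v\<close> or 0, which makes every Poincare summand at most 1.\<close>

lemma linear_stat_variance_le:
  assumes "dobrushin V J \<eta>" "\<eta> > 0" "A \<subseteq> V" "\<And>u. u \<in> A \<Longrightarrow> \<bar>a u\<bar> \<le> 1"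
  shows "E (\<lambda>x. E (\<lambda>y. (\<Sum>u\<in>A. a u * (x u - y u)) ^ 2)) \<le> 2 * real (card V) / \<eta>"
proof -
  have fin: "finite A" using assms(3) finite_V finite_subset by blast
  define L where "L x = (\<Sum>u\<in>A. a u * x u)" for x :: "'a \<Rightarrow> real"
  have "((L (x(v := 1)) - L (x(v := -1))) / 2) ^ 2 \<le> 1" for x v
  proof (cases "v \<in> A")
    case True
    have "L (x(v := s)) = a v * s + (\<Sum>u\<in>A - {v}. a u * x u)" for s
      unfolding L_def using True fin by (subst sum.remove[of A v]) auto
    then show ?thesis using assms(4)[OF True] by (simp add: abs_square_le_1)
  next
    case False
    then have "L (x(v := s)) = L x" for s
      unfolding L_def by (intro sum.cong) auto
    then show ?thesis by simp
  qed
  then have "E (\<lambda>x. ((L (x(v := 1)) - L (x(v := -1))) / 2) ^ 2) \<le> E (\<lambda>x. 1)" for v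
    by (intro E_mono)
  then have "(\<Sum>v\<in>V. E (\<lambda>x. ((L (x(v := 1)) - L (x(v := -1))) / 2) ^ 2)) \<le> (\<Sum>v\<in>V. 1)"
    by (intro sum_mono) (simp add: E_const)
  with poincare[OF assms(1,2), of L]
  have var: "E (\<lambda>x. (L x - E L) ^ 2) \<le> real (card V) / \<eta>"
    using assms(2) by (smt (verit) divide_right_mono real_of_card)
  have "E (\<lambda>x. E (\<lambda>y. (\<Sum>u\<in>A. a u * (x u - y u)) ^ 2)) = E (\<lambda>x. E (\<lambda>y. (L y - L x) ^ 2))"
    by (simp add: L_def right_diff_distrib sum_subtractf power2_commute)
  also have "\<dots> = 2 * E (\<lambda>x. (L x - E L) ^ 2)"
    by (subst E_square_decomp) (simp add: E_add E_const power2_commute)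
  finally show ?thesis using var by simp
qed

text \<open>The statistic is affine in each spin of the first sample; the slope is a linear
  statistic, and the last term cancels in a discrete derivative.\<close>

lemma bilinear_stat_upd:
  assumes "v \<in> V"
  shows "bilinear_stat V c (x(v := s), y)
    = (\<Sum>u\<in>V - {v}. c {u, v} * (x u - y u)) * (s - y v) + bilinear_stat (V - {v}) c (x, y)"
  unfolding bilinear_stat_def
  by (subst sum_nsets_2_remove[OF finite_V assms])
    (auto intro!: arg_cong2[where f = "(+)"] sum.cong prod.cong simp: nsets_def subset_iff sum_distrib_right)

text \<open>The constant collects 2 from symmetrisation, \<open>1 / \<eta>\<close> from the Poincare
  inequality in the first sample, and \<open>card V\<close> derivatives of second moment at most
  \<open>2 * real (card V) / \<eta>\<close>.\<close>

lemma bilinear_stat_variance_le: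
  assumes "dobrushin V J \<eta>" "\<eta> > 0" and c: "\<forall>e\<in>nsets V 2. c e \<in> {-1..1}"
  shows "measure_pmf.variance (pair_pmf (ising V h J) (ising V h J)) (bilinear_stat V c)
    \<le> 4 * real (card V) ^ 2 / \<eta> ^ 2"
proof -
  let ?G = "bilinear_stat V c"
  let ?L = "\<lambda>v x y. \<Sum>u\<in>V - {v}. c {u, v} * (x u - y u)"
  \<comment> \<open>Every product has exactly two factors, so the two sign changes cancel.\<close>
  have sym: "?G (x, y) = ?G (y, x)" for x y
  proof -
    have "(\<Prod>v\<in>e. x v - y v) = (\<Prod>v\<in>e. y v - x v)" if e: "e \<in> nsets V 2" for e
    proof -
      obtain a b where "e = {a, b}" "a \<noteq> b"
        using e by (auto simp: nsets_2_eq)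
      then show ?thesis by (simp add: algebra_simps)
    qed
    then show ?thesis unfolding bilinear_stat_def by (auto intro: sum.cong)
  qed
  have grad: "((?G (x(v := 1), y) - ?G (x(v := -1), y)) / 2) ^ 2 = ?L v x y ^ 2" if "v \<in> V" for v x y
    by (simp add: bilinear_stat_upd[OF that] algebra_simps)
  have lin: "E (\<lambda>y. E (\<lambda>x. ?L v x y ^ 2)) \<le> 2 * real (card V) / \<eta>" if v: "v \<in> V" for v
  proof (subst E_swap, rule linear_stat_variance_le[OF assms(1,2)])
    fix u assume "u \<in> V - {v}"
    then have "{u, v} \<in> nsets V 2" using v by (auto simp: nsets_2_eq)
    then show "\<bar>c {u, v}\<bar> \<le> 1" using c by (auto simp: abs_le_iff)
  qed auto
  have "E (\<lambda>y. E (\<lambda>x. (?G (x, y) - E (\<lambda>x. ?G (x, y))) ^ 2)) \<le> E (\<lambda>y. (\<Sum>v\<in>V. E (\<lambda>x. ?L v x y ^ 2)) / \<eta>)"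
  proof (rule E_mono)
    fix y
    show "E (\<lambda>x. (?G (x, y) - E (\<lambda>x. ?G (x, y))) ^ 2) \<le> (\<Sum>v\<in>V. E (\<lambda>x. ?L v x y ^ 2)) / \<eta>"
      using poincare[OF assms(1,2), of "\<lambda>x. ?G (x, y)"] by (simp only: grad cong: sum.cong)
  qed
  also have "\<dots> = (\<Sum>v\<in>V. E (\<lambda>y. E (\<lambda>x. ?L v x y ^ 2))) / \<eta>"
    using E_cmult[of "1 / \<eta>"] by (simp add: E_sum)
  also have "\<dots> \<le> (\<Sum>v\<in>V. 2 * real (card V) / \<eta>) / \<eta>"
    using assms(2) lin by (intro divide_right_mono sum_mono) auto
  also have "\<dots> = 2 * real (card V) ^ 2 / \<eta> ^ 2"
    by (simp add: power2_eq_square)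
  finally show ?thesis
    using variance_symmetric_le[of ?G, OF sym] by simp
qed

end

theorem theorem17:
  fixes \<eta> :: real
  assumes "\<eta> > 0"
  shows "\<exists>B \<in> soft_O (\<lambda>n. real n ^ 2).
    \<forall>(V :: 'a set) (h :: 'a \<Rightarrow> real) (J :: 'a set \<Rightarrow> real) (c :: 'a set \<Rightarrow> real).
      finite V \<longrightarrow> dobrushin V J \<eta> \<longrightarrow> (\<forall>e\<in>nsets V 2. c e \<in> {-1..1}) \<longrightarrow>
      measure_pmf.variance (pair_pmf (ising V h J) (ising V h J)) (bilinear_stat V c)
        \<le> B (card V)"
\<comment> \<open>The witness depends on \<open>\<eta>\<close> alone, and the power 0 of the
  logarithm suffices.\<close>
proof (intro bexI[of _ "\<lambda>n. 4 / \<eta> ^ 2 * real n ^ 2"] allI impI)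
  show "(\<lambda>n. 4 / \<eta> ^ 2 * real n ^ 2) \<in> soft_O (\<lambda>n. real n ^ 2)"
    unfolding soft_O_def by (auto intro!: exI[of _ 0] bigoI[of _ "4 / \<eta> ^ 2"])
next
  fix V :: "'a set" and h :: "'a \<Rightarrow> real" and J c :: "'a set \<Rightarrow> real"
  assume "finite V" and D: "dobrushin V J \<eta>" and c: "\<forall>e\<in>nsets V 2. c e \<in> {-1..1}"
  then interpret ising_model V h J by unfold_locales
  show "measure_pmf.variance (pair_pmf (ising V h J) (ising V h J)) (bilinear_stat V c)
      \<le> 4 / \<eta> ^ 2 * real (card V) ^ 2"
    using bilinear_stat_variance_le[OF D assms c] by simp
qed

end
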